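(* Let $f_h=AABCAA.BCB$, $f_e=AABCAAB.AABCAB.AABCB$, and let $f$ be a formula such that $f_h\preceq f\preceq f_e$. Every binary recurrent infinite word avoiding $f$ is equivalent to $b_2$.
   Context: A formula is a finite set of non-empty words over variables $A,B,C,\dots$ (fragments), written separated by dots. An occurrence of a formula $f$ in a word $w$ is a non-erasing morphism $h$ from variables to non-empty words such that $h(\phi)$ is a factor of $w$ for every fragment $\phi$ of $f$; $w$ avoids $f$ if it has no occurrence. $g\preceq f$ means there is a non-erasing morphism $h$ such that the $h$-image of every fragment of $g$ is a factor of some fragment of $f$. An infinite word is recurrent if each of its finite factors occurs infinitely often; two infinite words are equivalent if they have the same set of finite factors. $b_2$ is the Thue–Morse word, the fixed point starting with $0$ of the morphism $0\mapsto 01,\ 1\mapsto 10$. *)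

theory Defs
  imports Main "HOL-Library.Sublist"
begin

type_synonym formula = "nat list set"

definition is_formula :: "formula \<Rightarrow> bool" where
  "is_formula f \<longleftrightarrow> finite f \<and> [] \<notin> f"

definition morph :: "('a \<Rightarrow> 'b list) \<Rightarrow> 'a list \<Rightarrow> 'b list" where
  "morph h u = concat (map h u)"

definition nonerasing :: "('a \<Rightarrow> 'b list) \<Rightarrow> bool" where
  "nonerasing h \<longleftrightarrow> (\<forall>x. h x \<noteq> [])"

definition occurs_at :: "'a list \<Rightarrow> (nat \<Rightarrow> 'a) \<Rightarrow> nat \<Rightarrow> bool" where
  "occurs_at u w i \<longleftrightarrow> map w [i..<i + length u] = u"

definition factors :: "(nat \<Rightarrow> 'a) \<Rightarrow> 'a list set" where
  "factors w = {u. \<exists>i. occurs_at u w i}"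

definition occurrence :: "(nat \<Rightarrow> 'a list) \<Rightarrow> formula \<Rightarrow> (nat \<Rightarrow> 'a) \<Rightarrow> bool" where
  "occurrence h f w \<longleftrightarrow> nonerasing h \<and> (\<forall>\<phi>\<in>f. morph h \<phi> \<in> factors w)"

definition avoids :: "(nat \<Rightarrow> 'a) \<Rightarrow> formula \<Rightarrow> bool" where
  "avoids w f \<longleftrightarrow> \<not> (\<exists>h. occurrence h f w)"

definition formula_le :: "formula \<Rightarrow> formula \<Rightarrow> bool" (infix "\<preceq>" 50) where
  "g \<preceq> f \<longleftrightarrow> (\<exists>h. nonerasing h \<and> (\<forall>\<phi>\<in>g. \<exists>\<psi>\<in>f. sublist (morph h \<phi>) \<psi>))"

definition recurrent :: "(nat \<Rightarrow> 'a) \<Rightarrow> bool" where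
  "recurrent w \<longleftrightarrow> (\<forall>u\<in>factors w. infinite {i. occurs_at u w i})"

definition equivalent :: "(nat \<Rightarrow> 'a) \<Rightarrow> (nat \<Rightarrow> 'a) \<Rightarrow> bool" where
  "equivalent v w \<longleftrightarrow> factors v = factors w"

definition binary :: "(nat \<Rightarrow> nat) \<Rightarrow> bool" where
  "binary w \<longleftrightarrow> range w \<subseteq> {0, 1}"

text \<open>For non-erasing \<open>h\<close> the image of the prefix of length \<open>n + 1\<close> has length at
  least \<open>n + 1\<close>, so the list access below is always in range.\<close>

definition inf_morph :: "('a \<Rightarrow> 'b list) \<Rightarrow> (nat \<Rightarrow> 'a) \<Rightarrow> nat \<Rightarrow> 'b" where
  "inf_morph h w n = morph h (map w [0..<Suc n]) ! n"

definition tm_morphism :: "nat \<Rightarrow> nat list" where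
  "tm_morphism x = (if x = 0 then [0, 1] else [1, 0])"

definition b\<^sub>2 :: "nat \<Rightarrow> nat" where
  "b\<^sub>2 = (THE w. w 0 = 0 \<and> inf_morph tm_morphism w = w)"

definition f\<^sub>h :: formula where
  "f\<^sub>h = (let A = 0; B = 1; C = 2 in {[A,A,B,C,A,A], [B,C,B]})"

definition f\<^sub>e :: formula where
  "f\<^sub>e = (let A = 0; B = 1; C = 2 in
     {[A,A,B,C,A,A,B], [A,A,B,C,A,B], [A,A,B,C,B]})"


text \<open>The description defining \<open>b\<^sub>2\<close> is proper.\<close>

lemma morph_tm_nth:
  "n < 2 * length u \<Longrightarrow> morph tm_morphism u ! n = tm_morphism (u ! (n div 2)) ! (n mod 2)"
proof (induction u arbitrary: n)
  case Nil
  then show ?case by simp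
next
  case (Cons a u)
  have len: "length (tm_morphism a) = 2" by (simp add: tm_morphism_def)
  show ?case
  proof (cases "n < 2")
    case True
    then show ?thesis by (simp add: morph_def nth_append len)
  next
    case False
    then obtain m where n: "n = m + 2" by (metis add.commute le_Suc_ex not_less)
    then have "m < 2 * length u" using Cons.prems by simp
    then show ?thesis using Cons.IH[of m] n by (simp add: morph_def nth_append len)
  qed
qed

lemma inf_morph_tm: "inf_morph tm_morphism w n = tm_morphism (w (n div 2)) ! (n mod 2)"
proof -
  have "n div 2 < Suc n" by (simp add: le_imp_less_Suc)
  then have "map w [0..<Suc n] ! (n div 2) = w (n div 2)"
    by (subst nth_map) (simp_all del: upt_Suc)
  then show ?thesis
    unfolding inf_morph_def by (subst morph_tm_nth) (simp_all del: upt_Suc)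
qed

fun tm_rec :: "nat \<Rightarrow> nat" where
  "tm_rec n = (if n = 0 then 0 else tm_morphism (tm_rec (n div 2)) ! (n mod 2))"

declare tm_rec.simps [simp del]

lemma b2_ex1: "\<exists>!w. w 0 = 0 \<and> inf_morph tm_morphism w = w"
proof (rule ex1I)
  show "tm_rec 0 = 0 \<and> inf_morph tm_morphism tm_rec = tm_rec"
  proof
    show t0: "tm_rec 0 = 0" by (simp add: tm_rec.simps)
    show "inf_morph tm_morphism tm_rec = tm_rec"
    proof
      fix n show "inf_morph tm_morphism tm_rec n = tm_rec n"
        using t0 by (cases "n = 0")
          (simp_all add: inf_morph_tm tm_rec.simps[of n] tm_morphism_def)
    qed
  qed
next
  fix w :: "nat \<Rightarrow> nat"
  assume w: "w 0 = 0 \<and> inf_morph tm_morphism w = w"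
  have "w n = tm_rec n" for n
  proof (induction n rule: less_induct)
    case (less n)
    have "w n = tm_morphism (w (n div 2)) ! (n mod 2)"
      using w inf_morph_tm[of w n] by metis
    then show ?case
      using w less[of "n div 2"] by (cases "n = 0") (simp_all add: tm_rec.simps[of n] tm_rec.simps[of 0])
  qed
  then show "w = tm_rec" by blast
qed

lemma b2_fixed_point: "b\<^sub>2 0 = 0" "inf_morph tm_morphism b\<^sub>2 = b\<^sub>2"
  using theI'[OF b2_ex1] unfolding b\<^sub>2_def by blast+

end

theory Submission
  imports Defs
begin

text \<open>In a recurrent word, an overlap \<open>AAB\<close>, with \<open>B\<close> the first letter of \<open>A\<close>, comes back as
  \<open>AABCAAB\<close>. Since \<open>AB\<close> and \<open>B\<close> are prefixes of \<open>AAB\<close>, this single factor contains all three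
  fragments of \<open>f\<^sub>e\<close>, so a recurrent word avoiding \<open>f\<^sub>e\<close> is overlap-free. An overlap-free binary
  word is, after deleting a finite prefix, the Thue--Morse image of an overlap-free binary
  word. Iterating, for every \<open>n\<close> a suffix of the word is the image under the \<open>n\<close>-th power of the
  Thue--Morse morphism; recurrence moves any factor into that suffix, where it is covered by the
  images of two consecutive letters.\<close>

section \<open>Factors, avoidance and overlaps in recurrent words\<close>

lemma morph_append: "morph h (u @ v) = morph h u @ morph h v"
  by (simp add: morph_def)

lemma morph_morph: "morph g (morph h u) = morph (\<lambda>x. morph g (h x)) u"
  by (induction u) (simp_all add: morph_def)

lemma nonerasing_morph:
  assumes "nonerasing g" "u \<noteq> []"
  shows "morph g u \<noteq> []"
  using assms by (cases u) (simp_all add: morph_def nonerasing_def)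

lemma map_interval_in_factors:
  assumes "i \<le> j"
  shows "map w [i..<j] \<in> factors w"
  using assms unfolding factors_def occurs_at_def by (auto intro!: exI[of _ i])

lemma factors_sublist:
  assumes "v \<in> factors w" "sublist u v"
  shows "u \<in> factors w"
proof -
  obtain xs ys where v: "v = xs @ u @ ys" using assms(2) by (auto simp: sublist_def)
  obtain i where i: "map w [i..<i + length v] = v"
    using assms(1) by (auto simp: factors_def occurs_at_def)
  have "u = take (length u) (drop (length xs) v)" using v by simp
  also have "\<dots> = take (length u) (drop (length xs) (map w [i..<i + length v]))"
    using i by simp
  also have "\<dots> = map w [i + length xs..<i + length xs + length u]"
    using v by (simp add: drop_map take_map)
  finally show ?thesis by (metis map_interval_in_factors le_add1)
qed

text \<open>Composing an occurrence \<open>h\<close> of \<open>g\<close> with the morphism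
  \<open>k\<close> that witnesses \<open>f \<preceq> g\<close> gives an occurrence of
  \<open>f\<close>.\<close>

lemma avoids_mono:
  assumes "f \<preceq> g" "avoids w f"
  shows "avoids w g"
  unfolding avoids_def
proof
  assume "\<exists>h. occurrence h g w"
  then obtain h where h: "nonerasing h" "\<And>\<psi>. \<psi> \<in> g \<Longrightarrow> morph h \<psi> \<in> factors w"
    by (auto simp: occurrence_def)
  obtain k where k: "nonerasing k" "\<And>\<phi>. \<phi> \<in> f \<Longrightarrow> \<exists>\<psi>\<in>g. sublist (morph k \<phi>) \<psi>"
    using assms(1) by (auto simp: formula_le_def)
  have "morph (\<lambda>x. morph h (k x)) \<phi> \<in> factors w" if "\<phi> \<in> f" for \<phi>
  proof -
    obtain \<psi> where "\<psi> \<in> g" "sublist (morph k \<phi>) \<psi>" using k(2) \<open>\<phi> \<in> f\<close> by blast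
    then have "sublist (morph h (morph k \<phi>)) (morph h \<psi>)"
      unfolding sublist_def by (metis morph_append)
    then show ?thesis using h(2)[OF \<open>\<psi> \<in> g\<close>] by (simp add: morph_morph factors_sublist)
  qed
  moreover have "nonerasing (\<lambda>x. morph h (k x))"
    using h(1) k(1) by (simp add: nonerasing_def nonerasing_morph)
  ultimately show False using assms(2) by (auto simp: avoids_def occurrence_def)
qed

text \<open>The inclusive bound \<open>k \<le> p\<close> describes a factor of length
  \<open>2 * p + 1\<close> and period \<open>p\<close>, one letter more than a square.\<close>

definition overlap_free :: "(nat \<Rightarrow> 'a) \<Rightarrow> bool" where
  "overlap_free w \<longleftrightarrow> \<not> (\<exists>i p. 0 < p \<and> (\<forall>k\<le>p. w (i + k) = w (i + p + k)))"

lemma recurrent_occurs_beyond: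
  assumes "recurrent w" "u \<in> factors w"
  obtains j where "j > m" "occurs_at u w j"
proof -
  have "infinite {j. occurs_at u w j}" using assms by (auto simp: recurrent_def)
  then show ?thesis using that by (metis (lifting) finite_nat_set_iff_bounded_le mem_Collect_eq not_less)
qed

lemma map_interval_shift:
  "(\<And>k. k < n \<Longrightarrow> w (i + k) = w (j + k)) \<Longrightarrow> map w [i..<i + n] = map w [j..<j + n]"
  by (rule nth_equalityI) simp_all

lemma map_interval_append:
  "\<lbrakk>i \<le> j; j \<le> k\<rbrakk> \<Longrightarrow> map w [i..<j] @ map w [j..<k] = map w [i..<k]"
  by (metis le_Suc_ex map_append upt_add_eq_append)

lemma recurrent_avoids_imp_overlap_free:
  assumes "recurrent w" "avoids w f\<^sub>e"
  shows "overlap_free w"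
  unfolding overlap_free_def
proof clarify
  fix i p :: nat
  assume p: "0 < p" and ov: "\<forall>k\<le>p. w (i + k) = w (i + p + k)"
  define q where "q = 2 * p + 1"
  \<comment> \<open>A copy that starts strictly beyond \<open>i + q\<close> makes the gap
    \<open>C\<close> non-empty.\<close>
  obtain j where j: "i + q < j" "occurs_at (map w [i..<i + q]) w j"
    using recurrent_occurs_beyond[OF assms(1) map_interval_in_factors] le_add1 by blast
  have per: "w (j + k) = w (i + k)" if "k < q" for k
    using j(2) that unfolding occurs_at_def
    by (auto dest!: arg_cong[where f = "\<lambda>u. u ! k"])
  define A where "A = map w [i..<i + p]"
  define B where "B = [w i]"
  define C where "C = map w [i + q..<j]"
  define h where "h x = (if x = 0 then A else if x = 1 then B else C)" for x :: nat
  have A: "map w [i + p..<i + p + p] = A" "map w [j..<j + p] = A" "map w [j + p..<j + p + p] = A"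
    unfolding A_def
    by (intro map_interval_shift; use ov per p in \<open>simp add: q_def add.assoc\<close>)+
  have B: "map w [i + p + p..<i + q] = B" "map w [j..<j + 1] = B" "map w [j + p..<j + p + 1] = B"
    "map w [j + p + p..<j + q] = B"
    using ov[rule_format, of 0] ov[rule_format, of p] per[of 0] per[of p] per[of "2 * p"] p
    by (simp_all add: B_def q_def mult_2 add.assoc)
  have "A @ A @ B @ C = A @ A @ map w [i + p + p..<j]"
    using map_interval_append[of "i + p + p" "i + q" j w] j(1) unfolding C_def B(1)[symmetric]
    by (simp add: q_def del: upt_Suc)
  also have "\<dots> = A @ map w [i + p..<j]"
    using map_interval_append[of "i + p" "i + p + p" j w] A(1) j(1) by (simp add: q_def)
  also have "\<dots> = map w [i..<j]"
    using map_interval_append[of i "i + p" j w] j(1) by (simp add: q_def A_def)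
  finally have AABC: "A @ A @ B @ C = map w [i..<j]" .
  have AB: "A @ B = map w [j..<j + p + 1]"
    using map_interval_append[of j "j + p" "j + p + 1" w] A B by simp
  have AAB: "A @ A @ B = map w [j..<j + q]"
    using map_interval_append[of "j + p" "j + p + p" "j + q" w]
      map_interval_append[of j "j + p" "j + q" w] A B by (simp add: q_def)
  \<comment> \<open>Each fragment of \<open>f\<^sub>e\<close> is \<open>AABC\<close> followed by
    \<open>AAB\<close>, \<open>AB\<close> or \<open>B\<close>; these are prefixes of the copy at
    \<open>j\<close>, of lengths \<open>q\<close>, \<open>p + 1\<close> and
    \<open>1\<close>.\<close>
  have in_factors: "A @ A @ B @ C @ map w [j..<k] \<in> factors w" if "j \<le> k" for k
  proof -
    have "A @ A @ B @ C @ map w [j..<k] = map w [i..<j] @ map w [j..<k]"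
      using AABC by (metis append.assoc)
    also have "\<dots> = map w [i..<k]" using that j(1) by (intro map_interval_append) simp_all
    finally show ?thesis using that j(1) by (simp add: map_interval_in_factors)
  qed
  have "nonerasing h"
    using p j(1) by (simp add: nonerasing_def h_def A_def B_def C_def)
  moreover have "morph h \<phi> \<in> factors w" if "\<phi> \<in> f\<^sub>e" for \<phi>
    using that in_factors[of "j + q"] in_factors[of "j + p + 1"] in_factors[of "j + 1"] AAB AB B(2)
    by (auto simp: f\<^sub>e_def Let_def morph_def h_def)
  ultimately show False using assms(2) by (auto simp: avoids_def occurrence_def)
qed

section \<open>Desubstitution of overlap-free binary words\<close>

abbreviation tm_image :: "(nat \<Rightarrow> nat) \<Rightarrow> nat \<Rightarrow> nat" where
  "tm_image \<equiv> inf_morph tm_morphism"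

lemma tm_image_even: "tm_image v (2 * m) = (if v m = 0 then 0 else 1)"
  by (simp add: inf_morph_tm tm_morphism_def)

lemma tm_image_odd: "tm_image v (2 * m + 1) = (if v m = 0 then 1 else 0)"
  by (simp add: inf_morph_tm tm_morphism_def)

lemma overlap_freeD:
  assumes "overlap_free w" "0 < p"
  obtains k where "k \<le> p" "w (i + k) \<noteq> w (i + p + k)"
  using assms unfolding overlap_free_def by blast

lemma overlap_free_no_cube:
  assumes "overlap_free w"
  shows "\<not> (w i = w (i + 1) \<and> w (i + 1) = w (i + 2))"
  by (rule overlap_freeD[OF assms, of 1 i]) (auto simp: le_Suc_eq eval_nat_numeral)

lemma overlap_free_no_ababa:
  assumes "overlap_free w"
  shows "\<not> (w i = w (i + 2) \<and> w (i + 1) = w (i + 3) \<and> w (i + 2) = w (i + 4))"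
  by (rule overlap_freeD[OF assms, of 2 i]) (auto simp: le_Suc_eq eval_nat_numeral)

lemma overlap_free_no_abcabca:
  assumes "overlap_free w"
  shows "\<not> (w i = w (i + 3) \<and> w (i + 1) = w (i + 4) \<and> w (i + 2) = w (i + 5) \<and> w (i + 3) = w (i + 6))"
  by (rule overlap_freeD[OF assms, of 3 i]) (auto simp: le_Suc_eq eval_nat_numeral)

lemma binary_cases: "binary w \<Longrightarrow> w i = 0 \<or> w i = 1"
  by (auto simp: binary_def)

lemma binary_neq_neq: "\<lbrakk>binary w; w i \<noteq> w j; w j \<noteq> w k\<rbrakk> \<Longrightarrow> w i = w k"
  using binary_cases by metis

text \<open>The position must be positive: \<open>aabaa\<close> can be a prefix of an overlap-free word.\<close>

lemma overlap_free_no_aabaa: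
  assumes "overlap_free w" "binary w" "0 < i"
  shows "\<not> (w i = w (i + 1) \<and> w (i + 1) \<noteq> w (i + 2) \<and> w (i + 3) = w i \<and> w (i + 4) = w i)"
proof -
  obtain l where i: "i = l + 1" using assms(3) by (metis Suc_eq_plus1 gr0_conv_Suc)
  \<comment> \<open>If \<open>aabaa\<close> stands at \<open>l + 1\<close>, the exclusion of cubes
    forces \<open>b\<close> on both sides, and \<open>baabaab\<close> is an overlap of period
    3.\<close>
  show ?thesis
    using overlap_free_no_cube[OF assms(1), of l] overlap_free_no_cube[OF assms(1), of "l + 4"]
      overlap_free_no_abcabca[OF assms(1), of l]
      binary_cases[OF assms(2), of l] binary_cases[OF assms(2), of "l + 1"]
      binary_cases[OF assms(2), of "l + 3"] binary_cases[OF assms(2), of "l + 6"]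
    unfolding i by (auto simp: eval_nat_numeral)
qed

text \<open>This drives the division into blocks \<open>ab\<close> and \<open>ba\<close>, cut in the
  middle of the square. Equality in the first claim gives a cube, in the second \<open>aabaa\<close>
  or \<open>bbb\<close>; failure of the third gives an alternating \<open>ababa\<close> from
  \<open>i + 1\<close>.\<close>

lemma overlap_free_after_square:
  assumes "overlap_free w" "binary w" "0 < i" "w i = w (i + 1)"
  shows "w (i + 1) \<noteq> w (i + 2)" "w (i + 3) \<noteq> w (i + 4)"
    "w (i + 2) = w (i + 3) \<or> w (i + 4) = w (i + 5)"
proof -
  note third = binary_neq_neq[OF assms(2)]
  have cube: "\<not> (w (i + 2) = w (i + 3) \<and> w (i + 3) = w (i + 4))"
    using overlap_free_no_cube[OF assms(1), of "i + 2"] by (simp add: eval_nat_numeral)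
  have ababa: "\<not> (w (i + 1) = w (i + 3) \<and> w (i + 2) = w (i + 4) \<and> w (i + 3) = w (i + 5))"
    using overlap_free_no_ababa[OF assms(1), of "i + 1"] by (simp add: eval_nat_numeral)
  show 1: "w (i + 1) \<noteq> w (i + 2)"
    using assms(4) overlap_free_no_cube[OF assms(1), of i] by blast
  show 2: "w (i + 3) \<noteq> w (i + 4)"
    using 1 cube assms(4) overlap_free_no_aabaa[OF assms(1-3)] third[of "i + 1" "i + 2" "i + 3"]
    by metis
  show "w (i + 2) = w (i + 3) \<or> w (i + 4) = w (i + 5)"
    using 1 2 ababa third[of "i + 1" "i + 2" "i + 3"] third[of "i + 2" "i + 3" "i + 4"]
      third[of "i + 3" "i + 4" "i + 5"] by blast
qed

text \<open>Without a square, the letters at positions 1 to 5 would alternate and form the overlap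
  \<open>ababa\<close>. Position 0 is left out because the exclusion of \<open>aabaa\<close> relies
  on a preceding letter.\<close>

lemma overlap_free_has_square:
  assumes "overlap_free w" "binary w"
  obtains i where "0 < i" "w i = w (i + 1)"
proof -
  note third = binary_neq_neq[OF assms(2)]
  have "w 1 = w 2 \<or> w 2 = w 3 \<or> w 3 = w 4 \<or> w 4 = w 5"
    using overlap_free_no_ababa[OF assms(1), of 1] third[of 1 2 3] third[of 2 3 4] third[of 3 4 5]
    by (auto simp: eval_nat_numeral)
  then show ?thesis
    using that[of 1] that[of 2] that[of 3] that[of 4] by (auto simp: eval_nat_numeral)
qed

text \<open>An overlap of \<open>v\<close> at \<open>i\<close> with period \<open>p\<close> becomes
  one of \<open>w\<close> at \<open>s + 2 * i\<close> with period \<open>2 * p\<close>.\<close>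

lemma overlap_free_of_tm_image_suffix:
  assumes "overlap_free w" "\<And>m. w (s + m) = tm_image v m"
  shows "overlap_free v"
  unfolding overlap_free_def
proof clarify
  fix i p :: nat
  assume p: "0 < p" and ov: "\<forall>k\<le>p. v (i + k) = v (i + p + k)"
  have "w (s + 2 * i + k) = w (s + 2 * i + 2 * p + k)" if "k \<le> 2 * p" for k
  proof -
    have "tm_image v (2 * i + k) = tm_image v (2 * i + 2 * p + k)"
      using ov[rule_format, of "k div 2"] that
      by (simp add: inf_morph_tm distrib_left[symmetric] add.assoc del: distrib_left_numeral)
    then show ?thesis using assms(2) by (metis add.assoc)
  qed
  then have "\<exists>j q. 0 < q \<and> (\<forall>k\<le>q. w (j + k) = w (j + q + k))"
    using p by (intro exI[of _ "s + 2 * i"] exI[of _ "2 * p"]) simp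
  then show False using assms(1) unfolding overlap_free_def by blast
qed

lemma overlap_free_desubstitute:
  assumes "overlap_free w" "binary w"
  obtains s v where "binary v" "overlap_free v" "\<And>m. w (s + m) = tm_image v m"
proof -
  obtain i where i: "0 < i" "w i = w (i + 1)" using overlap_free_has_square[OF assms] .
  \<comment> \<open>Besides the two distinct letters of block \<open>m\<close>, the induction keeps
    a square straddling one of its ends. A square on the left yields the next block through the last
    two claims of \<open>overlap_free_after_square\<close>, one on the right through its
    first.\<close>
  have step: "w (i + 2 * m + 1) \<noteq> w (i + 2 * m + 2) \<and>
    (w (i + 2 * m) = w (i + 2 * m + 1) \<or> w (i + 2 * m + 2) = w (i + 2 * m + 3))" for m
  proof (induction m)
    case 0
    then show ?case using overlap_free_after_square[OF assms i] i by simp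
  next
    case (Suc m)
    then consider "w (i + 2 * m) = w (i + 2 * m + 1)" | "w (i + 2 * m + 2) = w (i + 2 * m + 3)"
      by blast
    then show ?case
    proof cases
      case 1
      then show ?thesis using overlap_free_after_square[OF assms, of "i + 2 * m"] i(1)
        by (simp add: eval_nat_numeral)
    next
      case 2
      then show ?thesis using overlap_free_after_square(1)[OF assms, of "i + 2 * m + 2"] i(1)
        by (simp add: eval_nat_numeral)
    qed
  qed
  \<comment> \<open>The blocks start at \<open>i + 1\<close>, between the two letters of the square.
    \<open>v\<close> reads their first letters; over a binary alphabet the second letter is then the
    complement.\<close>
  define v where "v m = w (i + 1 + 2 * m)" for m
  have bin: "binary v" unfolding binary_def v_def image_subset_iff using binary_cases[OF assms(2)] by simp
  have "w (i + 1 + m) = tm_image v m" for m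
  proof (cases "even m")
    case True
    then obtain n where "m = 2 * n" by blast
    then show ?thesis using binary_cases[OF bin, of n] by (auto simp: tm_image_even v_def)
  next
    case False
    then obtain n where m: "m = 2 * n + 1" by (elim oddE)
    show ?thesis
      using step[of n] binary_cases[OF assms(2), of "i + 2 * n + 1"]
        binary_cases[OF assms(2), of "i + 2 * n + 2"]
      unfolding m tm_image_odd by (auto simp: v_def eval_nat_numeral)
  qed
  then show ?thesis
    using overlap_free_of_tm_image_suffix[OF assms(1)] by (intro that[OF bin]) blast+
qed

lemma tm_image_shift: "tm_image v (2 * s + m) = tm_image (\<lambda>k. v (s + k)) m"
  by (simp add: inf_morph_tm)

lemma overlap_free_desubstitute_power:
  assumes "overlap_free w" "binary w"
  shows "\<exists>s v. binary v \<and> overlap_free v \<and> (\<forall>m. w (s + m) = (tm_image ^^ n) v m)"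
  using assms
proof (induction n arbitrary: w)
  case 0
  then show ?case by (auto intro!: exI[of _ 0] exI[of _ w])
next
  case (Suc n)
  obtain s v where v: "binary v" "overlap_free v" "\<And>m. w (s + m) = tm_image v m"
    using overlap_free_desubstitute[OF Suc.prems] by blast
  obtain t u where u: "binary u" "overlap_free u" "\<And>m. v (t + m) = (tm_image ^^ n) u m"
    using Suc.IH[OF v(2,1)] by blast
  \<comment> \<open>The first \<open>t\<close> letters of \<open>v\<close> have an image of length
    \<open>2 * t\<close>, hence the combined offset.\<close>
  have "w (s + 2 * t + m) = (tm_image ^^ Suc n) u m" for m
    using v(3)[of "2 * t + m"] by (simp add: tm_image_shift u(3) add.assoc)
  then show ?case using u(1,2) by blast
qed

section \<open>Uniform blocks and comparison with the Thue--Morse word\<close>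

lemma tm_image_power_block:
  assumes "v q = v' q'" "r < 2 ^ n"
  shows "(tm_image ^^ n) v (q * 2 ^ n + r) = (tm_image ^^ n) v' (q' * 2 ^ n + r)"
  using assms(2)
proof (induction n arbitrary: r)
  case 0
  then show ?case using assms(1) by simp
next
  case (Suc n)
  \<comment> \<open>Halving a position keeps the block number \<open>q\<close> and shrinks the block
    length from \<open>2 ^ Suc n\<close> to \<open>2 ^ n\<close>, so letter \<open>q\<close> alone
    determines block \<open>q\<close>.\<close>
  have half: "(q * 2 ^ Suc n + r) div 2 = q * 2 ^ n + r div 2"
    "(q * 2 ^ Suc n + r) mod 2 = r mod 2" for q
  proof -
    have *: "q * 2 ^ Suc n + r = r + 2 * (q * 2 ^ n)" by simp
    show "(q * 2 ^ Suc n + r) div 2 = q * 2 ^ n + r div 2"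
      "(q * 2 ^ Suc n + r) mod 2 = r mod 2" unfolding * by (simp_all del: mult_2)
  qed
  have "r div 2 < 2 ^ n" using Suc.prems by simp
  then show ?case using Suc.IH[of "r div 2"] unfolding funpow.simps comp_def inf_morph_tm half by simp
qed

lemma tm_image_power_b2: "(tm_image ^^ n) b\<^sub>2 = b\<^sub>2"
  by (induction n) (simp_all add: b2_fixed_point)

text \<open>All four two-letter words are needed so that any two consecutive blocks of an iterated
  image also appear side by side in \<open>b\<^sub>2\<close>. The positions 0, 1, 2 and 5 are read
  off its prefix \<open>0110100\<close>.\<close>

lemma b2_pairs:
  assumes "a \<in> {0, 1}" "b \<in> {0, 1}"
  shows "\<exists>m. b\<^sub>2 m = a \<and> b\<^sub>2 (m + 1) = b"
proof -
  have rec: "b\<^sub>2 n = tm_morphism (b\<^sub>2 (n div 2)) ! (n mod 2)" for n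
    by (metis inf_morph_tm b2_fixed_point(2))
  have v: "b\<^sub>2 0 = 0" "b\<^sub>2 1 = 1" "b\<^sub>2 2 = 1" "b\<^sub>2 3 = 0" "b\<^sub>2 5 = 0" "b\<^sub>2 6 = 0"
    using b2_fixed_point(1) rec[of 1] rec[of 2] rec[of 3] rec[of 5] rec[of 6]
    by (simp_all add: tm_morphism_def)
  show ?thesis using assms v
    by (auto intro: exI[of _ 0] exI[of _ 1] exI[of _ 2] exI[of _ 5] simp: numeral_eq_Suc)
qed

lemma overlap_free_binary_has_zero:
  assumes "overlap_free v" "binary v"
  obtains q where "v q = 0"
  using overlap_free_no_cube[OF assms(1), of 0] binary_cases[OF assms(2)] by metis

lemma recurrent_overlap_free_factors_eq_b2:
  assumes "recurrent w" "overlap_free w" "binary w"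
  shows "factors w = factors b\<^sub>2"
proof (intro equalityI subsetI)
  fix u assume u: "u \<in> factors w"
  \<comment> \<open>With this \<open>n\<close>, the factor \<open>u\<close> is shorter than a block
    of length \<open>2 ^ n\<close> and so meets at most two consecutive blocks.\<close>
  define n where "n = length u"
  have n: "n < 2 ^ n" by simp
  obtain s v where v: "binary v" "\<And>m. w (s + m) = (tm_image ^^ n) v m"
    using overlap_free_desubstitute_power[OF assms(2,3), of n] by blast
  obtain j where j: "j > s" "occurs_at u w j" using recurrent_occurs_beyond[OF assms(1) u] .
  define q where "q = (j - s) div 2 ^ n"
  define r where "r = (j - s) mod 2 ^ n"
  have jqr: "j = s + (q * 2 ^ n + r)" using j(1) unfolding q_def r_def div_mult_mod_eq by simp
  have r: "r < 2 ^ n" by (simp add: r_def)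
  obtain m where m: "b\<^sub>2 m = v q" "b\<^sub>2 (m + 1) = v (q + 1)"
    using b2_pairs[of "v q" "v (q + 1)"] binary_cases[OF v(1)] by auto
  have "w (j + k) = b\<^sub>2 (m * 2 ^ n + r + k)" if "k < n" for k
  proof (cases "r + k < 2 ^ n")
    case True
    have "w (j + k) = (tm_image ^^ n) v (q * 2 ^ n + (r + k))"
      using v(2) jqr by (simp add: add.assoc)
    also have "\<dots> = (tm_image ^^ n) b\<^sub>2 (m * 2 ^ n + (r + k))"
      using m True by (intro tm_image_power_block) simp_all
    finally show ?thesis by (simp add: tm_image_power_b2 add.assoc)
  next
    case False
    define l where "l = r + k - 2 ^ n"
    have l: "r + k = 2 ^ n + l" "l < 2 ^ n" using False r n that unfolding l_def by linarith+
    have "w (j + k) = (tm_image ^^ n) v ((q + 1) * 2 ^ n + l)"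
    proof -
      have "j + k = s + ((q + 1) * 2 ^ n + l)" using jqr l(1) by simp
      then show ?thesis by (simp only: v(2))
    qed
    also have "\<dots> = (tm_image ^^ n) b\<^sub>2 ((m + 1) * 2 ^ n + l)"
      using m l(2) by (intro tm_image_power_block) simp_all
    also have "(m + 1) * 2 ^ n + l = m * 2 ^ n + r + k" using l(1) by simp
    finally show ?thesis by (simp add: tm_image_power_b2)
  qed
  then have "map b\<^sub>2 [m * 2 ^ n + r..<m * 2 ^ n + r + n] = map w [j..<j + n]"
    by (intro nth_equalityI) simp_all
  also have "\<dots> = u" using j(2) by (simp add: occurs_at_def n_def)
  finally show "u \<in> factors b\<^sub>2" by (metis map_interval_in_factors le_add1)
next
  fix u assume "u \<in> factors b\<^sub>2"
  then obtain i where i: "map b\<^sub>2 [i..<i + length u] = u" by (auto simp: factors_def occurs_at_def)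
  \<comment> \<open>The factor ends within the first \<open>n < 2 ^ n\<close> letters of
    \<open>b\<^sub>2\<close>, hence inside the \<open>n\<close>-th image of its first letter 0; any
    0 in \<open>v\<close> then yields a copy of it in \<open>w\<close>.\<close>
  define n where "n = i + length u"
  obtain s v where v: "binary v" "overlap_free v" "\<And>m. w (s + m) = (tm_image ^^ n) v m"
    using overlap_free_desubstitute_power[OF assms(2,3), of n] by blast
  obtain q where q: "v q = 0" using overlap_free_binary_has_zero[OF v(2,1)] .
  define t where "t = s + q * 2 ^ n"
  have "w (t + k) = b\<^sub>2 k" if "k < n" for k
  proof -
    have "k < 2 ^ n" using that less_exp[of n] by (rule less_trans)
    then show ?thesis
      using v(3) q b2_fixed_point(1) tm_image_power_block[of v q b\<^sub>2 0 k n]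
      by (simp add: t_def tm_image_power_b2 add.assoc)
  qed
  then have "map w [t + i..<t + i + length u] = map b\<^sub>2 [i..<i + length u]"
    by (intro nth_equalityI) (simp_all add: n_def add.assoc)
  then show "u \<in> factors w" using i by (metis map_interval_in_factors le_add1)
qed

theorem theorem11:
  fixes f :: formula and w :: "nat \<Rightarrow> nat"
  assumes "is_formula f"
    and "f\<^sub>h \<preceq> f" and "f \<preceq> f\<^sub>e"
    and "binary w" and "recurrent w" and "avoids w f"
  shows "equivalent w b\<^sub>2"
proof -
  have "overlap_free w"
    using recurrent_avoids_imp_overlap_free[OF assms(5)] avoids_mono[OF assms(3,6)] by blast
  then show ?thesis
    using recurrent_overlap_free_factors_eq_b2 assms(4,5) by (simp add: equivalent_def)
qed

end
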